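(* Let $p\ge 1$, let $T\ge 1$, and let $\mathcal{A}$ and $\mathcal{B}$ be two stagewise independent probability trees with $T$ stages, whose stage-$t$ outcomes take values in a set $\Xi_t$ carrying a distance function $d_t$, for $t=1,\dots,T$. Let $P_t$ and $Q_t$ denote the marginal distributions on $\Xi_t$ of the stage-$t$ outcome under $\mathcal{A}$ and $\mathcal{B}$, respectively. Let $w_1,\dots,w_T\ge 0$ be weights and let $d$ be a distance function on $\Xi_1\times\dots\times\Xi_T$ given by $$d^p(\xi,\zeta) = w_1\, d_1^p(\xi_1,\zeta_1)+\dots+w_T\, d_T^p(\xi_T,\zeta_T).$$ Then the nested distance between $\mathcal{A}$ and $\mathcal{B}$ (with respect to $d$) is equal to the weighted sum of the Wasserstein distances (with respect to $d_1,\dots,d_T$) between the marginal distributions of each stage: $$\mathbf{d}_{\mathrm{N}}^p(\mathcal{A},\mathcal{B}) = w_1\,\mathbf{d}_{\mathrm{W}}^p(P_1,Q_1)+\dots+w_T\,\mathbf{d}_{\mathrm{W}}^p(P_T,Q_T).$$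
   Context: **Probability trees.** A probability tree $\mathcal{A}$ with $T$ stages is a finite rooted tree whose node set is partitioned into stages $\mathcal{A}_1,\dots,\mathcal{A}_T$. The stage $\mathcal{A}_1$ consists of the root only. Every node in $\mathcal{A}_{t+1}$ is a child (successor) of exactly one node in $\mathcal{A}_t$, and all leaves are in $\mathcal{A}_T$. Write $k_+$ for the set of successors of a node $k$, and $i\succ k$ if the leaf $i\in\mathcal{A}_T$ lies in the subtree rooted at $k$ (a leaf lies in its own subtree). Each node $k\in\mathcal{A}_t$ carries an outcome in $\Xi_t$. A leaf $i$ determines a unique path from the root, hence a scenario $\xi^i=(\xi^i_1,\dots,\xi^i_T)\in\Xi_1\times\dots\times\Xi_T$. The tree carries a probability function $P$ on its leaves with $P(i)>0$ and $\sum_i P(i)=1$, extended to all nodes by $P(k)=\sum_{i\succ k}P(i)$. Conditional probabilities are $P(i\mid k)=P(i)/P(k)$ for leaves $i\succ k$ (and $0$ otherwise), and $P(m\mid k)=\sum_{i\succ m}P(i\mid k)$ for a general node $m$. For the tree $\mathcal{B}$ the same notions are used with probability function $Q$, nodes $l$, leaves $j$, and scenarios $\zeta^j$. **Stagewise independence.** The tree $\mathcal{A}$ is stagewise independent if, for each $t<T$, all nodes of $\mathcal{A}_t$ have the same successors with the same probabilities. That is, for any two nodes $k,k'\in\mathcal{A}_t$ there is a bijection $k_+\to k'_+$ preserving the outcome in $\Xi_{t+1}$ and the conditional probability (if $r\mapsto r'$, then $P(r\mid k)=P(r'\mid k')$). Equivalently, the associated process $(\xi_t)_{t=1}^T$ has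 each $\xi_{t+1}$ independent of $(\xi_1,\dots,\xi_t)$. The same definition applies to $\mathcal{B}$. **Wasserstein distance.** For finitely supported probability measures $P=\sum_{a=1}^m p_a\delta_{x_a}$ and $Q=\sum_{b=1}^n q_b\delta_{y_b}$ on a set with distance function $\delta$, $\mathbf{d}_{\mathrm{W}}^p(P,Q)$ denotes the optimal value of $$\min_{\pi\in\mathbb{R}^{m\times n}}\ \sum_{a,b}\delta(x_a,y_b)^p\,\pi_{a,b}\quad\text{s.t.}\quad \sum_b\pi_{a,b}=p_a\ \forall a,\quad \sum_a\pi_{a,b}=q_b\ \forall b,\quad \pi_{a,b}\ge 0.$$ **Nested distance.** $\mathbf{d}_{\mathrm{N}}^p(\mathcal{A},\mathcal{B})$ denotes the optimal value of the following problem over $\pi=(\pi_{i,j})_{i\in\mathcal{A}_T,\,j\in\mathcal{B}_T}$: $$\min_\pi\ \sum_{i,j} d(\xi^i,\zeta^j)^p\,\pi_{i,j}$$ subject to $\pi_{i,j}\ge 0$, $\sum_{i,j}\pi_{i,j}=1$, and, for every stage $t$ and all nodes $k\in\mathcal{A}_t$, $l\in\mathcal{B}_t$, $$\sum_{j\succ l}\pi_{i,j}=P(i\mid k)\,\pi_{k,l}\ \ \text{for all leaves } i\succ k,\qquad \sum_{i\succ k}\pi_{i,j}=Q(j\mid l)\,\pi_{k,l}\ \ \text{for all leaves } j\succ l,$$ where $\pi_{k,l}:=\sum_{i\succ k,\ j\succ l}\pi_{i,j}$. *)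

theory Defs
  imports "HOL-Probability.Probability_Mass_Function" "HOL-Library.FuncSet"
begin

(* The outcome sets of all stages live in one type 'x and are given as a family Xi t of
   subsets of it; this loses no generality, since 'x may be a disjoint union.  Only
   stages 1, ..., num_stages are meaningful.  leaf_prob is used on leaves only; it is
   extended to all nodes by node_prob. *)
record ('n, 'x) ptree =
  num_stages :: nat
  stage :: "nat \<Rightarrow> 'n set"
  succs :: "'n \<Rightarrow> 'n set"
  outcome :: "'n \<Rightarrow> 'x"
  leaf_prob :: "'n \<Rightarrow> real"

definition leaves :: "('n, 'x) ptree \<Rightarrow> 'n set" where
  "leaves A = stage A (num_stages A)"

locale probability_tree =
  fixes Xi :: "nat \<Rightarrow> 'x set" and A :: "('n, 'x) ptree"
  assumes num_stages: "1 \<le> num_stages A"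
    and finite_stage: "t \<in> {1..num_stages A} \<Longrightarrow> finite (stage A t)"
    and stages_disjoint:
      "\<lbrakk>s \<in> {1..num_stages A}; t \<in> {1..num_stages A}; s \<noteq> t\<rbrakk> \<Longrightarrow> stage A s \<inter> stage A t = {}"
    and root: "\<exists>r. stage A 1 = {r}"
    and succs_in_next_stage:
      "\<lbrakk>t \<in> {1..<num_stages A}; k \<in> stage A t\<rbrakk> \<Longrightarrow> succs A k \<subseteq> stage A (Suc t)"
    and unique_parent:
      "\<lbrakk>t \<in> {1..<num_stages A}; m \<in> stage A (Suc t)\<rbrakk> \<Longrightarrow> \<exists>!k. k \<in> stage A t \<and> m \<in> succs A k"
    and inner_nodes: "\<lbrakk>t \<in> {1..<num_stages A}; k \<in> stage A t\<rbrakk> \<Longrightarrow> succs A k \<noteq> {}"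
    and final_nodes: "k \<in> leaves A \<Longrightarrow> succs A k = {}"
    and outcome_in: "\<lbrakk>t \<in> {1..num_stages A}; k \<in> stage A t\<rbrakk> \<Longrightarrow> outcome A k \<in> Xi t"
    and leaf_prob_pos: "i \<in> leaves A \<Longrightarrow> 0 < leaf_prob A i"
    and leaf_prob_sum: "(\<Sum>i\<in>leaves A. leaf_prob A i) = 1"

definition edges :: "('n, 'x) ptree \<Rightarrow> ('n \<times> 'n) set" where
  "edges A = {(k, m). m \<in> succs A k}"

definition leaves_below :: "('n, 'x) ptree \<Rightarrow> 'n \<Rightarrow> 'n set" where
  "leaves_below A k = {i \<in> leaves A. (k, i) \<in> (edges A)\<^sup>*}"

(* The stage-t node on the path from the root to the leaf i. *)
definition ancestor :: "('n, 'x) ptree \<Rightarrow> nat \<Rightarrow> 'n \<Rightarrow> 'n" where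
  "ancestor A t i = (THE k. k \<in> stage A t \<and> (k, i) \<in> (edges A)\<^sup>*)"

definition scenario :: "('n, 'x) ptree \<Rightarrow> 'n \<Rightarrow> nat \<Rightarrow> 'x" where
  "scenario A i = (\<lambda>t\<in>{1..num_stages A}. outcome A (ancestor A t i))"

definition node_prob :: "('n, 'x) ptree \<Rightarrow> 'n \<Rightarrow> real" where
  "node_prob A k = (\<Sum>i\<in>leaves_below A k. leaf_prob A i)"

definition leaf_cond_prob :: "('n, 'x) ptree \<Rightarrow> 'n \<Rightarrow> 'n \<Rightarrow> real" where
  "leaf_cond_prob A i k = (if i \<in> leaves_below A k then leaf_prob A i / node_prob A k else 0)"

definition cond_prob :: "('n, 'x) ptree \<Rightarrow> 'n \<Rightarrow> 'n \<Rightarrow> real" where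
  "cond_prob A m k = (\<Sum>i\<in>leaves_below A m. leaf_cond_prob A i k)"

definition stagewise_independent :: "('n, 'x) ptree \<Rightarrow> bool" where
  "stagewise_independent A \<longleftrightarrow>
    (\<forall>t\<in>{1..<num_stages A}. \<forall>k\<in>stage A t. \<forall>k'\<in>stage A t.
      \<exists>f. bij_betw f (succs A k) (succs A k') \<and>
        (\<forall>r\<in>succs A k. outcome A (f r) = outcome A r \<and>
          cond_prob A r k = cond_prob A (f r) k'))"

definition leaf_pmf :: "('n, 'x) ptree \<Rightarrow> 'n pmf" where
  "leaf_pmf A = embed_pmf (\<lambda>i. if i \<in> leaves A then leaf_prob A i else 0)"

definition marginal :: "('n, 'x) ptree \<Rightarrow> nat \<Rightarrow> 'x pmf" where
  "marginal A t = map_pmf (\<lambda>i. scenario A i t) (leaf_pmf A)"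

(* Distinct points may have distance 0: a distance built from stage distances with
   weights that are allowed to vanish does not separate points in general.
   Every metric is a distance function in this sense. *)
definition distance_on :: "'x set \<Rightarrow> ('x \<Rightarrow> 'x \<Rightarrow> real) \<Rightarrow> bool" where
  "distance_on X d \<longleftrightarrow>
    (\<forall>x\<in>X. \<forall>y\<in>X. 0 \<le> d x y) \<and>
    (\<forall>x\<in>X. d x x = 0) \<and>
    (\<forall>x\<in>X. \<forall>y\<in>X. d x y = d y x) \<and>
    (\<forall>x\<in>X. \<forall>y\<in>X. \<forall>z\<in>X. d x z \<le> d x y + d y z)"

definition transport_plans :: "'x pmf \<Rightarrow> 'x pmf \<Rightarrow> ('x \<Rightarrow> 'x \<Rightarrow> real) set" where
  "transport_plans P Q = {\<pi>.
    (\<forall>x\<in>set_pmf P. (\<Sum>y\<in>set_pmf Q. \<pi> x y) = pmf P x) \<and>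
    (\<forall>y\<in>set_pmf Q. (\<Sum>x\<in>set_pmf P. \<pi> x y) = pmf Q y) \<and>
    (\<forall>x\<in>set_pmf P. \<forall>y\<in>set_pmf Q. 0 \<le> \<pi> x y)}"

(* The p-th power of the Wasserstein distance, for finitely supported P and Q. *)
definition wasserstein_pow ::
    "real \<Rightarrow> ('x \<Rightarrow> 'x \<Rightarrow> real) \<Rightarrow> 'x pmf \<Rightarrow> 'x pmf \<Rightarrow> real" where
  "wasserstein_pow p d P Q =
    (INF \<pi>\<in>transport_plans P Q. \<Sum>x\<in>set_pmf P. \<Sum>y\<in>set_pmf Q. d x y powr p * \<pi> x y)"

definition node_mass ::
    "('a, 'x) ptree \<Rightarrow> ('b, 'x) ptree \<Rightarrow> ('a \<Rightarrow> 'b \<Rightarrow> real) \<Rightarrow> 'a \<Rightarrow> 'b \<Rightarrow> real" where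
  "node_mass A B \<pi> k l = (\<Sum>i\<in>leaves_below A k. \<Sum>j\<in>leaves_below B l. \<pi> i j)"

definition nested_plans ::
    "('a, 'x) ptree \<Rightarrow> ('b, 'x) ptree \<Rightarrow> ('a \<Rightarrow> 'b \<Rightarrow> real) set" where
  "nested_plans A B = {\<pi>.
    (\<forall>i\<in>leaves A. \<forall>j\<in>leaves B. 0 \<le> \<pi> i j) \<and>
    (\<Sum>i\<in>leaves A. \<Sum>j\<in>leaves B. \<pi> i j) = 1 \<and>
    (\<forall>t\<in>{1..num_stages A}. \<forall>k\<in>stage A t. \<forall>l\<in>stage B t.
      (\<forall>i\<in>leaves_below A k.
        (\<Sum>j\<in>leaves_below B l. \<pi> i j) = leaf_cond_prob A i k * node_mass A B \<pi> k l) \<and>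
      (\<forall>j\<in>leaves_below B l.
        (\<Sum>i\<in>leaves_below A k. \<pi> i j) = leaf_cond_prob B j l * node_mass A B \<pi> k l))}"

(* The p-th power of the nested distance, for trees with the same number of stages. *)
definition nested_pow ::
    "real \<Rightarrow> ((nat \<Rightarrow> 'x) \<Rightarrow> (nat \<Rightarrow> 'x) \<Rightarrow> real) \<Rightarrow> ('a, 'x) ptree \<Rightarrow> ('b, 'x) ptree \<Rightarrow> real"
  where
  "nested_pow p d A B =
    (INF \<pi>\<in>nested_plans A B.
      \<Sum>i\<in>leaves A. \<Sum>j\<in>leaves B. d (scenario A i) (scenario B j) powr p * \<pi> i j)"

end

theory Submission
  imports Defs
begin

text \<open>The cost of a nested plan is a weighted sum over the stages, and the cost of one stage depends
  only on the image of the plan under the stage-\<open>t\<close> outcomes. This image is a transport plan between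
  the stage marginals, because the constraints at the two roots fix the leaf marginals of the nested
  plan (\<open>stage_plan_transport\<close>). So the nested distance is never below the weighted sum of the
  Wasserstein distances.

  Stagewise independence makes this bound sharp: arbitrary plans \<open>\<tau>\<^sub>t\<close> for the single stages can
  then be glued to one nested plan. With the densities
  \<open>h\<^sub>t(x, y) = \<tau>\<^sub>t(x, y) / (P\<^sub>t(x) Q\<^sub>t(y))\<close> the glued plan is
  \<open>\<pi>(i, j) = P(i) Q(j) \<Prod>\<^sub>t h\<^sub>t(\<xi>\<^sup>i\<^sub>t, \<zeta>\<^sup>j\<^sub>t)\<close>. For \<open>x\<close> in the support of \<open>P\<^sub>t\<close> the mean of
  \<open>h\<^sub>t(x, y)\<close> under \<open>Q\<^sub>t\<close> is one, and symmetrically in the other variable. Since future stages are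
  independent of the past (\<open>mean_of_future_product\<close>), summing \<open>\<pi>(i, j)\<close> over the leaves \<open>j\<close> below a
  node \<open>l\<close> of stage \<open>t\<close> removes all factors after stage \<open>t\<close>. What remains is \<open>P(i) Q(l)\<close> times a
  factor that depends on the common past only, and this is the proportionality to \<open>P(i)\<close> that a nested
  plan requires (\<open>density_plan_conditional\<close>). By the same product rule the image of \<open>\<pi>\<close> at stage \<open>t\<close>
  is \<open>\<tau>\<^sub>t\<close>, so that the cost of \<open>\<pi>\<close> is the weighted sum of the costs of the \<open>\<tau>\<^sub>t\<close>
  (\<open>nested_plan_of_stage_plans\<close>). Choosing the \<open>\<tau>\<^sub>t\<close> optimal up to an arbitrarily small error
  gives the theorem.\<close>

section \<open>Paths and leaves of a probability tree\<close>

context probability_tree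
begin

lemma finite_leaves: "finite (leaves A)"
  using finite_stage num_stages by (simp add: leaves_def)

lemma finite_leaves_below: "finite (leaves_below A k)"
  using finite_leaves by (simp add: leaves_below_def)

lemma stage_unique:
  assumes "s \<in> {1..num_stages A}" "t \<in> {1..num_stages A}" "k \<in> stage A s" "k \<in> stage A t"
  shows "s = t"
  using stages_disjoint assms by blast

lemma reachable_in_later_stage:
  assumes "(k, m) \<in> (edges A)\<^sup>*" "t \<in> {1..num_stages A}" "k \<in> stage A t"
  shows "\<exists>s\<in>{t..num_stages A}. m \<in> stage A s \<and> (s = t \<longrightarrow> m = k)"
  using assms(1)
proof (induction rule: rtrancl_induct)
  case base
  then show ?case using assms by auto
next
  case (step m n)
  then obtain s where s: "s \<in> {t..num_stages A}" "m \<in> stage A s" by blast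
  have n: "n \<in> succs A m" using step.hyps by (simp add: edges_def)
  then have "s \<noteq> num_stages A" using s final_nodes by (auto simp: leaves_def)
  then have "s \<in> {1..<num_stages A}" using s assms(2) by auto
  then have "n \<in> stage A (Suc s)" using succs_in_next_stage s(2) n by blast
  moreover have "Suc s \<in> {t..num_stages A}" "Suc s \<noteq> t"
    using s(1) \<open>s \<in> {1..<num_stages A}\<close> by auto
  ultimately show ?case by blast
qed

text \<open>Uniqueness goes back along the path from \<open>m\<close>: its last edge starts in the stage before that of
  \<open>m\<close>, hence at the unique parent of \<open>m\<close>.\<close>

lemma unique_ancestor:
  assumes "1 \<le> t" "t \<le> s" "s \<le> num_stages A" "m \<in> stage A s"
  shows "\<exists>!k. k \<in> stage A t \<and> (k, m) \<in> (edges A)\<^sup>*"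
  using assms(2,3,4)
proof (induction s arbitrary: m rule: dec_induct)
  case base
  have "k = m" if "k \<in> stage A t" "(k, m) \<in> (edges A)\<^sup>*" for k
    using reachable_in_later_stage[OF that(2) _ that(1)] stage_unique base assms(1)
    by (metis atLeastAtMost_iff order_trans)
  then show ?case using base by blast
next
  case (step s)
  have s: "s \<in> {1..<num_stages A}" using step.hyps step.prems assms(1) by auto
  obtain n where n: "n \<in> stage A s" "m \<in> succs A n"
      and n_unique: "\<And>n'. n' \<in> stage A s \<Longrightarrow> m \<in> succs A n' \<Longrightarrow> n' = n"
    using unique_parent[OF s step.prems(2)] by blast
  obtain k where k: "k \<in> stage A t" "(k, n) \<in> (edges A)\<^sup>*"
      and k_unique: "\<And>k'. k' \<in> stage A t \<Longrightarrow> (k', n) \<in> (edges A)\<^sup>* \<Longrightarrow> k' = k"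
    using step.IH[OF _ n(1)] s by auto
  have "(k, m) \<in> (edges A)\<^sup>*"
    using k(2) n(2) by (auto simp: edges_def intro: rtrancl_into_rtrancl)
  moreover have "k' = k" if k': "k' \<in> stage A t" "(k', m) \<in> (edges A)\<^sup>*" for k'
  proof -
    have "k' \<noteq> m"
      using stage_unique[of t "Suc s" m] k'(1) step.hyps step.prems s assms(1) by auto
    then obtain n' where n': "(k', n') \<in> (edges A)\<^sup>*" "m \<in> succs A n'"
      using k'(2) by (auto simp: edges_def elim: rtranclE)
    obtain s' where s': "s' \<in> {t..num_stages A}" "n' \<in> stage A s'"
      using reachable_in_later_stage[OF n'(1) _ k'(1)] s step.hyps assms(1) by auto
    have "s' \<noteq> num_stages A" using s' n' final_nodes by (auto simp: leaves_def)
    then have "s' \<in> {1..<num_stages A}" using s' assms(1) by auto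
    then have "m \<in> stage A (Suc s')" using succs_in_next_stage s'(2) n'(2) by blast
    then have "Suc s' = Suc s"
      using stage_unique[of "Suc s'" "Suc s" m] step.prems s \<open>s' \<in> {1..<num_stages A}\<close> by auto
    then show ?thesis using n_unique k_unique k' n' s' by auto
  qed
  ultimately show ?case using k(1) by blast
qed

lemma ancestor_eq:
  assumes "t \<in> {1..num_stages A}" "k \<in> stage A t" "i \<in> leaves_below A k"
  shows "ancestor A t i = k"
  unfolding ancestor_def
  by (rule the1_equality, rule unique_ancestor[of t "num_stages A"])
    (use assms in \<open>auto simp: leaves_below_def leaves_def\<close>)

lemma ancestor_in_stage:
  assumes "t \<in> {1..num_stages A}" "i \<in> leaves A"
  shows "ancestor A t i \<in> stage A t" "i \<in> leaves_below A (ancestor A t i)"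
proof -
  have "\<exists>!k. k \<in> stage A t \<and> (k, i) \<in> (edges A)\<^sup>*"
    using unique_ancestor[of t "num_stages A" i] assms by (auto simp: leaves_def)
  then have "ancestor A t i \<in> stage A t \<and> (ancestor A t i, i) \<in> (edges A)\<^sup>*"
    unfolding ancestor_def by (rule theI')
  then show "ancestor A t i \<in> stage A t" "i \<in> leaves_below A (ancestor A t i)"
    using assms(2) by (auto simp: leaves_below_def)
qed

lemma scenario_in: "i \<in> leaves A \<Longrightarrow> scenario A i \<in> (\<Pi>\<^sub>E t\<in>{1..num_stages A}. Xi t)"
  using ancestor_in_stage outcome_in by (auto simp: scenario_def)

lemma scenario_at_node:
  assumes "t \<in> {1..num_stages A}" "k \<in> stage A t" "i \<in> leaves_below A k"
  shows "scenario A i t = outcome A k"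
  using ancestor_eq[OF assms] assms(1) by (simp add: scenario_def)

text \<open>Leaves below a common stage-\<open>t\<close> node share the path from the root to that node, hence the
  first \<open>t\<close> outcomes.\<close>

lemma scenario_prefix:
  assumes "t \<in> {1..num_stages A}" "k \<in> stage A t" "i \<in> leaves_below A k" "i' \<in> leaves_below A k"
    and s: "s \<in> {1..t}"
  shows "scenario A i s = scenario A i' s"
proof -
  obtain n where n: "n \<in> stage A s" "(n, k) \<in> (edges A)\<^sup>*"
    using unique_ancestor[of s t k] assms by auto
  then have "i \<in> leaves_below A n" "i' \<in> leaves_below A n"
    using assms(3,4) by (auto simp: leaves_below_def)
  then show ?thesis using scenario_at_node[of s n] n(1) assms(1) s by auto
qed

lemma leaves_below_leaf:
  assumes "k \<in> leaves A"
  shows "leaves_below A k = {k}"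
proof -
  have "num_stages A \<in> {1..num_stages A}" using num_stages by auto
  then have "i = k" if "i \<in> leaves_below A k" for i
    using reachable_in_later_stage[of k i "num_stages A"] that assms
    by (auto simp: leaves_below_def leaves_def)
  then show ?thesis using assms by (auto simp: leaves_below_def)
qed

lemma leaves_below_disjoint:
  assumes "t \<in> {1..num_stages A}" "k \<in> stage A t" "k' \<in> stage A t" "k \<noteq> k'"
  shows "leaves_below A k \<inter> leaves_below A k' = {}"
  using ancestor_eq assms by blast

lemma leaves_below_inner:
  assumes "t \<in> {1..<num_stages A}" "k \<in> stage A t"
  shows "leaves_below A k = (\<Union>m\<in>succs A k. leaves_below A m)"
proof
  show "leaves_below A k \<subseteq> (\<Union>m\<in>succs A k. leaves_below A m)"
  proof
    fix i assume i: "i \<in> leaves_below A k"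
    have "k \<noteq> i"
      using stage_unique[of t "num_stages A" i] i assms by (auto simp: leaves_below_def leaves_def)
    then obtain m where "m \<in> succs A k" "(m, i) \<in> (edges A)\<^sup>*"
      using i by (auto simp: leaves_below_def edges_def elim: converse_rtranclE)
    then show "i \<in> (\<Union>m\<in>succs A k. leaves_below A m)" using i by (auto simp: leaves_below_def)
  qed
qed (auto simp: leaves_below_def edges_def intro: converse_rtrancl_into_rtrancl)

lemma sum_leaves_below_inner:
  fixes g :: "'n \<Rightarrow> real"
  assumes "t \<in> {1..<num_stages A}" "k \<in> stage A t"
  shows "(\<Sum>i\<in>leaves_below A k. g i) = (\<Sum>m\<in>succs A k. \<Sum>i\<in>leaves_below A m. g i)"
proof -
  have sub: "succs A k \<subseteq> stage A (Suc t)" using succs_in_next_stage assms by blast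
  then have "finite (succs A k)" using finite_stage[of "Suc t"] assms by (auto intro: finite_subset)
  moreover have "\<forall>m\<in>succs A k. \<forall>m'\<in>succs A k. m \<noteq> m' \<longrightarrow> leaves_below A m \<inter> leaves_below A m' = {}"
    using leaves_below_disjoint[of "Suc t"] sub assms(1) by fastforce
  ultimately show ?thesis
    unfolding leaves_below_inner[OF assms]
    by (intro sum.UNION_disjoint) (auto simp: finite_leaves_below)
qed

lemma sum_leaves_by_stage:
  fixes g :: "'n \<Rightarrow> real"
  assumes "t \<in> {1..num_stages A}"
  shows "(\<Sum>i\<in>leaves A. g i) = (\<Sum>k\<in>stage A t. \<Sum>i\<in>leaves_below A k. g i)"
proof -
  have "leaves A = (\<Union>k\<in>stage A t. leaves_below A k)"
    using ancestor_in_stage[OF assms] by (auto simp: leaves_below_def)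
  moreover have "(\<Sum>i\<in>(\<Union>k\<in>stage A t. leaves_below A k). g i)
      = (\<Sum>k\<in>stage A t. \<Sum>i\<in>leaves_below A k. g i)"
    using leaves_below_disjoint[OF assms]
    by (intro sum.UNION_disjoint) (auto simp: finite_leaves_below finite_stage[OF assms])
  ultimately show ?thesis by simp
qed

lemma leaves_below_nonempty:
  assumes "1 \<le> t" "t \<le> num_stages A" "k \<in> stage A t"
  shows "leaves_below A k \<noteq> {}"
  using assms(2,1,3)
proof (induction t arbitrary: k rule: inc_induct)
  case base
  then show ?case using leaves_below_leaf by (simp add: leaves_def)
next
  case (step t)
  then have t: "t \<in> {1..<num_stages A}" by auto
  obtain m where "m \<in> succs A k" using inner_nodes[OF t] step.prems by blast
  moreover then have "leaves_below A m \<noteq> {}"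
    using step.IH[of m] succs_in_next_stage[OF t] step.prems by auto
  ultimately show ?case using leaves_below_inner[OF t] step.prems by auto
qed

lemma node_prob_pos:
  assumes "t \<in> {1..num_stages A}" "k \<in> stage A t"
  shows "0 < node_prob A k"
  unfolding node_prob_def
  using leaves_below_nonempty[of t k] assms leaf_prob_pos finite_leaves_below
  by (intro sum_pos) (auto simp: leaves_below_def)

lemma root_leaves_below:
  assumes "stage A 1 = {r}"
  shows "leaves_below A r = leaves A"
  using ancestor_in_stage[of 1] num_stages assms by (auto simp: leaves_below_def)

lemma root_prob:
  assumes "stage A 1 = {r}"
  shows "node_prob A r = 1"
  using leaf_prob_sum root_leaves_below[OF assms] by (simp add: node_prob_def)

end

section \<open>Stage means and the product rule\<close>

definition stage_mean :: "('n, 'x) ptree \<Rightarrow> nat \<Rightarrow> ('x \<Rightarrow> real) \<Rightarrow> real" where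
  "stage_mean A t f = (\<Sum>i\<in>leaves A. leaf_prob A i * f (scenario A i t))"

context probability_tree
begin

text \<open>By stagewise independence, the conditional mean of \<open>f\<close> over the successors of a stage-\<open>t\<close> node
  is one and the same number for all these nodes; averaging over the nodes identifies this number
  with the unconditional mean.\<close>

lemma successor_mean:
  assumes indep: "stagewise_independent A" and t: "t \<in> {1..<num_stages A}" and k: "k \<in> stage A t"
  shows "(\<Sum>m\<in>succs A k. node_prob A m * f (outcome A m)) = node_prob A k * stage_mean A (Suc t) f"
proof -
  define c where "c = (\<lambda>k. \<Sum>m\<in>succs A k. cond_prob A m k * f (outcome A m))"
  have t': "t \<in> {1..num_stages A}" and Suc_t: "Suc t \<in> {1..num_stages A}" using t by auto
  have cond: "node_prob A n * cond_prob A m n = node_prob A m" if "n \<in> stage A t" "m \<in> succs A n" for n m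
  proof -
    have "leaves_below A m \<subseteq> leaves_below A n" using leaves_below_inner[OF t that(1)] that(2) by auto
    then have "cond_prob A m n = (\<Sum>i\<in>leaves_below A m. leaf_prob A i / node_prob A n)"
      unfolding cond_prob_def by (intro sum.cong) (auto simp: leaf_cond_prob_def)
    then show ?thesis
      using node_prob_pos[OF t' that(1)] by (simp add: node_prob_def[of A m] flip: sum_divide_distrib)
  qed
  have step: "(\<Sum>m\<in>succs A n. node_prob A m * f (outcome A m)) = node_prob A n * c n"
    if "n \<in> stage A t" for n
    unfolding c_def sum_distrib_left
    by (intro sum.cong refl) (simp add: cond[OF that, symmetric])
  have const: "c n = c k" if n: "n \<in> stage A t" for n
  proof -
    obtain g where g: "bij_betw g (succs A k) (succs A n)"
      and "\<forall>r\<in>succs A k. outcome A (g r) = outcome A r \<and> cond_prob A r k = cond_prob A (g r) n"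
      using indep t k n unfolding stagewise_independent_def by meson
    then have "c k = (\<Sum>m\<in>succs A k. cond_prob A (g m) n * f (outcome A (g m)))"
      by (simp add: c_def)
    also have "\<dots> = c n"
      unfolding c_def by (rule sum.reindex_bij_betw[OF g])
    finally show ?thesis by simp
  qed
  have "stage_mean A (Suc t) f
      = (\<Sum>n\<in>stage A t. \<Sum>m\<in>succs A n. \<Sum>i\<in>leaves_below A m. leaf_prob A i * f (scenario A i (Suc t)))"
    unfolding stage_mean_def sum_leaves_by_stage[OF t']
    by (intro sum.cong refl sum_leaves_below_inner[OF t])
  also have "\<dots> = (\<Sum>n\<in>stage A t. \<Sum>m\<in>succs A n. node_prob A m * f (outcome A m))"
    unfolding node_prob_def sum_distrib_right
  proof (intro sum.cong refl)
    fix n m i assume n: "n \<in> stage A t" and m: "m \<in> succs A n" and i: "i \<in> leaves_below A m"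
    have "m \<in> stage A (Suc t)" using succs_in_next_stage[OF t n] m by blast
    then have "scenario A i (Suc t) = outcome A m" using i by (rule scenario_at_node[OF Suc_t])
    then show "leaf_prob A i * f (scenario A i (Suc t)) = leaf_prob A i * f (outcome A m)" by simp
  qed
  also have "\<dots> = (\<Sum>n\<in>stage A t. node_prob A n * c k)"
    using step const by (intro sum.cong) auto
  also have "\<dots> = c k"
    using sum_leaves_by_stage[OF t', of "leaf_prob A"] leaf_prob_sum
    by (simp add: node_prob_def flip: sum_distrib_right)
  finally show ?thesis using step[OF k] by simp
qed

text \<open>Stagewise independence in the form in which it is used: given a node of stage \<open>t\<close>, the outcomes
  of the stages after \<open>t\<close> are independent and have their unconditional distributions.\<close>

lemma mean_of_future_product:
  assumes indep: "stagewise_independent A"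
    and "1 \<le> t" "t \<le> num_stages A" "k \<in> stage A t"
  shows "(\<Sum>i\<in>leaves_below A k. leaf_prob A i * (\<Prod>s\<in>{t<..num_stages A}. f s (scenario A i s)))
    = node_prob A k * (\<Prod>s\<in>{t<..num_stages A}. stage_mean A s (f s))"
  using assms(3,2,4)
proof (induction t arbitrary: k rule: inc_induct)
  case base
  then show ?case by (simp add: node_prob_def)
next
  case (step t)
  then have t: "t \<in> {1..<num_stages A}" and Suc_t: "Suc t \<in> {1..num_stages A}" by auto
  have k: "k \<in> stage A t" using step.prems by simp
  have interval: "{t<..num_stages A} = insert (Suc t) {Suc t<..num_stages A}" using t by auto
  let ?c = "\<Prod>s\<in>{Suc t<..num_stages A}. stage_mean A s (f s)"
  have "(\<Sum>i\<in>leaves_below A k. leaf_prob A i * (\<Prod>s\<in>{t<..num_stages A}. f s (scenario A i s)))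
    = (\<Sum>m\<in>succs A k. \<Sum>i\<in>leaves_below A m.
        leaf_prob A i * (\<Prod>s\<in>{t<..num_stages A}. f s (scenario A i s)))"
    by (rule sum_leaves_below_inner[OF t k])
  also have "\<dots> = (\<Sum>m\<in>succs A k. node_prob A m * f (Suc t) (outcome A m) * ?c)"
  proof (rule sum.cong[OF refl])
    fix m assume "m \<in> succs A k"
    then have m: "m \<in> stage A (Suc t)" using succs_in_next_stage[OF t k] by auto
    have "(\<Sum>i\<in>leaves_below A m. leaf_prob A i * (\<Prod>s\<in>{t<..num_stages A}. f s (scenario A i s)))
      = (\<Sum>i\<in>leaves_below A m. f (Suc t) (outcome A m) *
          (leaf_prob A i * (\<Prod>s\<in>{Suc t<..num_stages A}. f s (scenario A i s))))"
      by (intro sum.cong refl) (simp add: interval scenario_at_node[OF Suc_t m])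
    also have "\<dots> = f (Suc t) (outcome A m) * (node_prob A m * ?c)"
      using step.IH[OF _ m] by (simp flip: sum_distrib_left)
    finally show "(\<Sum>i\<in>leaves_below A m.
        leaf_prob A i * (\<Prod>s\<in>{t<..num_stages A}. f s (scenario A i s)))
      = node_prob A m * f (Suc t) (outcome A m) * ?c" by simp
  qed
  also have "\<dots> = node_prob A k * stage_mean A (Suc t) (f (Suc t)) * ?c"
    using successor_mean[OF indep t k, of "f (Suc t)"] by (simp flip: sum_distrib_right)
  finally show ?case by (simp add: interval)
qed

lemma mean_of_product:
  assumes "stagewise_independent A"
  shows "(\<Sum>i\<in>leaves A. leaf_prob A i * (\<Prod>s\<in>{1..num_stages A}. f s (scenario A i s)))
    = (\<Prod>s\<in>{1..num_stages A}. stage_mean A s (f s))"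
proof -
  \<comment> \<open>The first stage has no predecessor; it is split off because its outcome is deterministic.\<close>
  obtain r where r: "stage A 1 = {r}" using root by blast
  have interval: "{1..num_stages A} = insert 1 {1<..num_stages A}" using num_stages by auto
  have r1: "scenario A i 1 = outcome A r" if "i \<in> leaves A" for i
    using scenario_at_node[of 1 r i] root_leaves_below[OF r] r num_stages that by auto
  have "stage_mean A 1 (f 1) = f 1 (outcome A r)"
    using r1 leaf_prob_sum by (simp add: stage_mean_def flip: sum_distrib_right)
  moreover have "(\<Sum>i\<in>leaves A. leaf_prob A i * (\<Prod>s\<in>{1..num_stages A}. f s (scenario A i s)))
    = (\<Sum>i\<in>leaves A. f 1 (outcome A r) *
        (leaf_prob A i * (\<Prod>s\<in>{1<..num_stages A}. f s (scenario A i s))))"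
    unfolding interval by (intro sum.cong refl) (simp add: r1[simplified])
  moreover have "\<dots> = f 1 (outcome A r) * (\<Prod>s\<in>{1<..num_stages A}. stage_mean A s (f s))"
    using mean_of_future_product[OF assms, of 1 r f] num_stages r root_leaves_below[OF r] root_prob[OF r]
    by (simp flip: sum_distrib_left)
  ultimately show ?thesis unfolding interval by simp
qed

text \<open>The past factors are constant below a node, and future factors of mean one do not contribute.\<close>

lemma mean_of_product_below:
  assumes "stagewise_independent A" and t: "t \<in> {1..num_stages A}" and k: "k \<in> stage A t"
    and i': "i' \<in> leaves_below A k"
    and one: "\<And>s. s \<in> {1..num_stages A} \<Longrightarrow> stage_mean A s (f s) = 1"
  shows "(\<Sum>i\<in>leaves_below A k. leaf_prob A i * (\<Prod>s\<in>{1..num_stages A}. f s (scenario A i s)))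
    = node_prob A k * (\<Prod>s\<in>{1..t}. f s (scenario A i' s))"
proof -
  have split: "(\<Prod>s\<in>{1..num_stages A}. g s) = (\<Prod>s\<in>{1..t}. g s) * (\<Prod>s\<in>{t<..num_stages A}. g s)"
    for g :: "nat \<Rightarrow> real"
  proof -
    have "{1..num_stages A} = {1..t} \<union> {t<..num_stages A}" using t by auto
    then show ?thesis by (simp add: prod.union_disjoint ivl_disj_int)
  qed
  have "(\<Sum>i\<in>leaves_below A k. leaf_prob A i * (\<Prod>s\<in>{1..num_stages A}. f s (scenario A i s)))
    = (\<Sum>i\<in>leaves_below A k. (\<Prod>s\<in>{1..t}. f s (scenario A i' s)) *
        (leaf_prob A i * (\<Prod>s\<in>{t<..num_stages A}. f s (scenario A i s))))"
  proof (rule sum.cong[OF refl])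
    fix i assume i: "i \<in> leaves_below A k"
    have "(\<Prod>s\<in>{1..t}. f s (scenario A i s)) = (\<Prod>s\<in>{1..t}. f s (scenario A i' s))"
      using scenario_prefix[OF t k i i'] by (intro prod.cong) auto
    then show "leaf_prob A i * (\<Prod>s\<in>{1..num_stages A}. f s (scenario A i s))
      = (\<Prod>s\<in>{1..t}. f s (scenario A i' s)) *
        (leaf_prob A i * (\<Prod>s\<in>{t<..num_stages A}. f s (scenario A i s)))"
      unfolding split by simp
  qed
  also have "\<dots> = (\<Prod>s\<in>{1..t}. f s (scenario A i' s)) * node_prob A k"
    using mean_of_future_product[OF assms(1), of t k f] t k one by (simp flip: sum_distrib_left)
  finally show ?thesis by simp
qed

section \<open>Stage marginals\<close>

lemma pmf_leaf_pmf: "pmf (leaf_pmf A) i = (if i \<in> leaves A then leaf_prob A i else 0)"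
  unfolding leaf_pmf_def
proof (rule pmf_embed_pmf)
  show "0 \<le> (if x \<in> leaves A then leaf_prob A x else 0)" for x
    using leaf_prob_pos by (simp add: less_imp_le)
  have "(\<integral>\<^sup>+ x. ennreal (if x \<in> leaves A then leaf_prob A x else 0) \<partial>count_space UNIV)
      = (\<integral>\<^sup>+ x. ennreal (leaf_prob A x) * indicator (leaves A) x \<partial>count_space UNIV)"
    by (intro nn_integral_cong) (auto simp: indicator_def)
  also have "\<dots> = (\<Sum>x\<in>leaves A. ennreal (leaf_prob A x))"
    by (simp add: nn_integral_count_space_indicator[symmetric] nn_integral_count_space_finite
        finite_leaves)
  also have "\<dots> = 1"
    using leaf_prob_sum leaf_prob_pos by (subst sum_ennreal) (auto simp: less_imp_le)
  finally show "(\<integral>\<^sup>+ x. ennreal (if x \<in> leaves A then leaf_prob A x else 0) \<partial>count_space UNIV) = 1" .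
qed

lemma set_leaf_pmf: "set_pmf (leaf_pmf A) = leaves A"
  using leaf_prob_pos by (auto simp: set_pmf_iff pmf_leaf_pmf split: if_splits) (metis less_irrefl)

lemma set_marginal: "set_pmf (marginal A t) = (\<lambda>i. scenario A i t) ` leaves A"
  by (simp add: marginal_def set_leaf_pmf)

lemma finite_set_marginal: "finite (set_pmf (marginal A t))"
  by (simp add: set_marginal finite_leaves)

lemma sum_leaves_by_outcome:
  fixes g :: "'n \<Rightarrow> real"
  shows "(\<Sum>x\<in>set_pmf (marginal A t). \<Sum>i | i \<in> leaves A \<and> scenario A i t = x. g i)
    = (\<Sum>i\<in>leaves A. g i)"
  by (intro sum.group) (auto simp: finite_leaves finite_set_marginal set_marginal)

lemma pmf_marginal: "pmf (marginal A t) x = (\<Sum>i | i \<in> leaves A \<and> scenario A i t = x. leaf_prob A i)"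
proof -
  have "pmf (marginal A t) x = measure (leaf_pmf A) ((\<lambda>i. scenario A i t) -` {x})"
    by (simp add: marginal_def pmf_map)
  also have "\<dots> = measure (leaf_pmf A) {i. i \<in> leaves A \<and> scenario A i t = x}"
    by (subst measure_Int_set_pmf[symmetric]) (auto simp: set_leaf_pmf intro!: arg_cong2[where f=measure])
  also have "\<dots> = (\<Sum>i | i \<in> leaves A \<and> scenario A i t = x. leaf_prob A i)"
    by (subst measure_measure_pmf_finite) (auto simp: finite_leaves pmf_leaf_pmf intro!: sum.cong)
  finally show ?thesis .
qed

lemma stage_mean_marginal:
  "stage_mean A t f = (\<Sum>x\<in>set_pmf (marginal A t). pmf (marginal A t) x * f x)"
proof -
  have "stage_mean A t f = (\<Sum>x\<in>set_pmf (marginal A t). \<Sum>i | i \<in> leaves A \<and> scenario A i t = x.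
      leaf_prob A i * f (scenario A i t))"
    unfolding stage_mean_def by (rule sum_leaves_by_outcome[symmetric])
  also have "\<dots> = (\<Sum>x\<in>set_pmf (marginal A t). pmf (marginal A t) x * f x)"
    unfolding pmf_marginal sum_distrib_right by (intro sum.cong) auto
  finally show ?thesis .
qed

end

section \<open>From a nested plan to stage plans\<close>

text \<open>The image of \<open>\<pi>\<close> under the pair of stage-\<open>t\<close> outcomes.\<close>

definition stage_plan :: "('a, 'x) ptree \<Rightarrow> ('b, 'x) ptree \<Rightarrow> ('a \<Rightarrow> 'b \<Rightarrow> real) \<Rightarrow> nat \<Rightarrow>
    'x \<Rightarrow> 'x \<Rightarrow> real" where
  "stage_plan A B \<pi> t x y =
    (\<Sum>i | i \<in> leaves A \<and> scenario A i t = x. \<Sum>j | j \<in> leaves B \<and> scenario B j t = y. \<pi> i j)"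

text \<open>At the two roots the constraints of a nested plan say that its marginals are the leaf
  distributions.\<close>

lemma nested_plan_leaf_marginals:
  assumes A: "probability_tree Xi A" and B: "probability_tree Xi B" and \<pi>: "\<pi> \<in> nested_plans A B"
  shows "i \<in> leaves A \<Longrightarrow> (\<Sum>j\<in>leaves B. \<pi> i j) = leaf_prob A i"
    and "j \<in> leaves B \<Longrightarrow> (\<Sum>i\<in>leaves A. \<pi> i j) = leaf_prob B j"
proof -
  interpret A: probability_tree Xi A by fact
  interpret B: probability_tree Xi B by fact
  obtain r r' where r: "stage A 1 = {r}" and r': "stage B 1 = {r'}"
    using A.root B.root by blast
  have "1 \<in> {1..num_stages A}" "r \<in> stage A 1" "r' \<in> stage B 1"
    using A.num_stages r r' by auto
  with \<pi> have
    "\<forall>i\<in>leaves_below A r. (\<Sum>j\<in>leaves_below B r'. \<pi> i j) = leaf_cond_prob A i r * node_mass A B \<pi> r r'"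
    "\<forall>j\<in>leaves_below B r'. (\<Sum>i\<in>leaves_below A r. \<pi> i j) = leaf_cond_prob B j r' * node_mass A B \<pi> r r'"
    unfolding nested_plans_def by blast+
  moreover have "node_mass A B \<pi> r r' = 1"
    using \<pi> by (simp add: nested_plans_def node_mass_def A.root_leaves_below[OF r]
        B.root_leaves_below[OF r'])
  ultimately have *:
    "\<forall>i\<in>leaves A. (\<Sum>j\<in>leaves B. \<pi> i j) = leaf_cond_prob A i r"
    "\<forall>j\<in>leaves B. (\<Sum>i\<in>leaves A. \<pi> i j) = leaf_cond_prob B j r'"
    by (simp_all add: A.root_leaves_below[OF r] B.root_leaves_below[OF r'])
  show "(\<Sum>j\<in>leaves B. \<pi> i j) = leaf_prob A i" if "i \<in> leaves A"
    using * that A.root_leaves_below[OF r] B.root_leaves_below[OF r'] A.root_prob[OF r]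
    by (simp add: leaf_cond_prob_def)
  show "(\<Sum>i\<in>leaves A. \<pi> i j) = leaf_prob B j" if "j \<in> leaves B"
    using * that A.root_leaves_below[OF r] B.root_leaves_below[OF r'] B.root_prob[OF r']
    by (simp add: leaf_cond_prob_def)
qed

lemma stage_plan_transport:
  assumes A: "probability_tree Xi A" and B: "probability_tree Xi B" and \<pi>: "\<pi> \<in> nested_plans A B"
  shows "stage_plan A B \<pi> t \<in> transport_plans (marginal A t) (marginal B t)"
proof -
  interpret A: probability_tree Xi A by fact
  interpret B: probability_tree Xi B by fact
  have "(\<Sum>y\<in>set_pmf (marginal B t). stage_plan A B \<pi> t x y) = pmf (marginal A t) x" for x
  proof -
    have "(\<Sum>y\<in>set_pmf (marginal B t). stage_plan A B \<pi> t x y)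
        = (\<Sum>i | i \<in> leaves A \<and> scenario A i t = x. \<Sum>j\<in>leaves B. \<pi> i j)"
      unfolding stage_plan_def by (subst sum.swap) (simp add: B.sum_leaves_by_outcome)
    also have "\<dots> = pmf (marginal A t) x"
      unfolding A.pmf_marginal
      by (intro sum.cong) (auto simp: nested_plan_leaf_marginals(1)[OF A B \<pi>])
    finally show ?thesis .
  qed
  moreover have "(\<Sum>x\<in>set_pmf (marginal A t). stage_plan A B \<pi> t x y) = pmf (marginal B t) y" for y
  proof -
    have "(\<Sum>x\<in>set_pmf (marginal A t). stage_plan A B \<pi> t x y)
        = (\<Sum>i\<in>leaves A. \<Sum>j | j \<in> leaves B \<and> scenario B j t = y. \<pi> i j)"
      unfolding stage_plan_def by (rule A.sum_leaves_by_outcome)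
    also have "\<dots> = (\<Sum>j | j \<in> leaves B \<and> scenario B j t = y. \<Sum>i\<in>leaves A. \<pi> i j)"
      by (rule sum.swap)
    also have "\<dots> = pmf (marginal B t) y"
      unfolding B.pmf_marginal
      by (intro sum.cong) (auto simp: nested_plan_leaf_marginals(2)[OF A B \<pi>])
    finally show ?thesis .
  qed
  moreover have "0 \<le> stage_plan A B \<pi> t x y" for x y
    using \<pi> unfolding stage_plan_def nested_plans_def by (intro sum_nonneg) auto
  ultimately show ?thesis unfolding transport_plans_def by simp
qed

lemma stage_plan_cost:
  fixes c :: "'x \<Rightarrow> 'x \<Rightarrow> real"
  assumes "probability_tree Xi A" and "probability_tree Xi B"
  shows "(\<Sum>x\<in>set_pmf (marginal A t). \<Sum>y\<in>set_pmf (marginal B t). c x y * stage_plan A B \<pi> t x y)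
    = (\<Sum>i\<in>leaves A. \<Sum>j\<in>leaves B. c (scenario A i t) (scenario B j t) * \<pi> i j)"
proof -
  interpret A: probability_tree Xi A by fact
  interpret B: probability_tree Xi B by fact
  have "(\<Sum>x\<in>set_pmf (marginal A t). \<Sum>y\<in>set_pmf (marginal B t). c x y * stage_plan A B \<pi> t x y)
    = (\<Sum>x\<in>set_pmf (marginal A t). \<Sum>i | i \<in> leaves A \<and> scenario A i t = x.
        \<Sum>y\<in>set_pmf (marginal B t). \<Sum>j | j \<in> leaves B \<and> scenario B j t = y.
          c (scenario A i t) (scenario B j t) * \<pi> i j)"
  proof (rule sum.cong[OF refl])
    fix x
    have "(\<Sum>y\<in>set_pmf (marginal B t). c x y * stage_plan A B \<pi> t x y)
      = (\<Sum>y\<in>set_pmf (marginal B t). \<Sum>i | i \<in> leaves A \<and> scenario A i t = x.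
          \<Sum>j | j \<in> leaves B \<and> scenario B j t = y. c (scenario A i t) (scenario B j t) * \<pi> i j)"
      unfolding stage_plan_def sum_distrib_left by (intro sum.cong) auto
    also have "\<dots> = (\<Sum>i | i \<in> leaves A \<and> scenario A i t = x. \<Sum>y\<in>set_pmf (marginal B t).
          \<Sum>j | j \<in> leaves B \<and> scenario B j t = y. c (scenario A i t) (scenario B j t) * \<pi> i j)"
      by (rule sum.swap)
    finally show "(\<Sum>y\<in>set_pmf (marginal B t). c x y * stage_plan A B \<pi> t x y) = \<dots>" .
  qed
  then show ?thesis by (simp only: A.sum_leaves_by_outcome B.sum_leaves_by_outcome)
qed

section \<open>From stage plans to a nested plan\<close>

text \<open>The functions \<open>h t\<close> are the densities of stage plans with respect to the products of the stage
  marginals. Using densities instead of the plans themselves accounts for siblings that carry the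
  same outcome: the mass of an outcome is shared among them in proportion to their
  probabilities.\<close>

definition density_plan :: "('a, 'x) ptree \<Rightarrow> ('b, 'x) ptree \<Rightarrow> (nat \<Rightarrow> 'x \<Rightarrow> 'x \<Rightarrow> real) \<Rightarrow>
    'a \<Rightarrow> 'b \<Rightarrow> real" where
  "density_plan A B h i j = leaf_prob A i * (leaf_prob B j *
    (\<Prod>t\<in>{1..num_stages B}. h t (scenario A i t) (scenario B j t)))"

lemma density_plan_swap:
  assumes "num_stages A = num_stages B"
  shows "density_plan A B h i j = density_plan B A (\<lambda>t x y. h t y x) j i"
  using assms by (simp add: density_plan_def)

text \<open>Summing over the leaves below \<open>l\<close> removes the densities of the stages after \<open>t\<close>. The
  densities up to \<open>t\<close> take the same value at all pairs of leaves below \<open>k\<close> and \<open>l\<close>, so the sum is the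
  probability of the leaf \<open>i\<close> times a constant of the pair of nodes.\<close>

lemma density_plan_conditional:
  assumes A: "probability_tree Xi A" and B: "probability_tree Xi B"
    and stages: "num_stages A = num_stages B" and indep: "stagewise_independent B"
    and h: "\<And>s i. s \<in> {1..num_stages B} \<Longrightarrow> i \<in> leaves A \<Longrightarrow> stage_mean B s (h s (scenario A i s)) = 1"
    and t: "t \<in> {1..num_stages B}" and k: "k \<in> stage A t" and l: "l \<in> stage B t"
    and i: "i \<in> leaves_below A k"
  shows "(\<Sum>j\<in>leaves_below B l. density_plan A B h i j)
    = leaf_cond_prob A i k * node_mass A B (density_plan A B h) k l"
proof -
  interpret A: probability_tree Xi A by fact
  interpret B: probability_tree Xi B by fact
  have tA: "t \<in> {1..num_stages A}" using t stages by simp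
  obtain j' where j': "j' \<in> leaves_below B l"
    using B.leaves_below_nonempty[of t l] t l by auto
  define past where "past = (\<Prod>s\<in>{1..t}. h s (scenario A i s) (scenario B j' s))"
  have inner: "(\<Sum>j\<in>leaves_below B l. density_plan A B h i' j) = leaf_prob A i' * (node_prob B l * past)"
    if i': "i' \<in> leaves_below A k" for i'
  proof -
    have leaf: "i' \<in> leaves A" using i' by (simp add: leaves_below_def)
    have "(\<Sum>j\<in>leaves_below B l. density_plan A B h i' j)
      = leaf_prob A i' * (node_prob B l * (\<Prod>s\<in>{1..t}. h s (scenario A i' s) (scenario B j' s)))"
      unfolding density_plan_def sum_distrib_left[symmetric]
      by (subst B.mean_of_product_below[OF indep t l j', where f="\<lambda>s. h s (scenario A i' s)"])
        (simp_all add: h leaf)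
    moreover have "(\<Prod>s\<in>{1..t}. h s (scenario A i' s) (scenario B j' s)) = past"
      unfolding past_def
      by (intro prod.cong refl) (simp add: A.scenario_prefix[OF tA k i' i])
    ultimately show ?thesis by simp
  qed
  have "node_mass A B (density_plan A B h) k l = node_prob A k * (node_prob B l * past)"
    by (simp add: node_mass_def inner node_prob_def[of A k] sum_distrib_right)
  then show ?thesis
    using inner[OF i] A.node_prob_pos[OF tA k] i by (simp add: leaf_cond_prob_def)
qed

lemma density_plan_nested:
  assumes A: "probability_tree Xi A" and B: "probability_tree Xi B"
    and stages: "num_stages A = num_stages B"
    and indepA: "stagewise_independent A" and indepB: "stagewise_independent B"
    and nonneg: "\<And>s i j. s \<in> {1..num_stages B} \<Longrightarrow> i \<in> leaves A \<Longrightarrow> j \<in> leaves B \<Longrightarrow>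
        0 \<le> h s (scenario A i s) (scenario B j s)"
    and hB: "\<And>s i. s \<in> {1..num_stages B} \<Longrightarrow> i \<in> leaves A \<Longrightarrow> stage_mean B s (h s (scenario A i s)) = 1"
    and hA: "\<And>s j. s \<in> {1..num_stages B} \<Longrightarrow> j \<in> leaves B \<Longrightarrow>
        stage_mean A s (\<lambda>x. h s x (scenario B j s)) = 1"
  shows "density_plan A B h \<in> nested_plans A B"
proof -
  interpret A: probability_tree Xi A by fact
  interpret B: probability_tree Xi B by fact
  have "0 \<le> density_plan A B h i j" if "i \<in> leaves A" "j \<in> leaves B" for i j
    using that A.leaf_prob_pos B.leaf_prob_pos nonneg
    by (auto simp: density_plan_def less_imp_le intro!: mult_nonneg_nonneg prod_nonneg)
  moreover have "(\<Sum>i\<in>leaves A. \<Sum>j\<in>leaves B. density_plan A B h i j) = 1"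
  proof -
    have "(\<Sum>j\<in>leaves B. density_plan A B h i j) = leaf_prob A i" if "i \<in> leaves A" for i
      unfolding density_plan_def sum_distrib_left[symmetric]
      by (subst B.mean_of_product[OF indepB, where f="\<lambda>s. h s (scenario A i s)"])
        (simp add: hB that)
    then show ?thesis by (simp add: A.leaf_prob_sum)
  qed
  moreover have "(\<Sum>j\<in>leaves_below B l. density_plan A B h i j)
      = leaf_cond_prob A i k * node_mass A B (density_plan A B h) k l"
    if "t \<in> {1..num_stages A}" "k \<in> stage A t" "l \<in> stage B t" "i \<in> leaves_below A k" for t k l i
    using that stages by (intro density_plan_conditional[OF A B stages indepB, where t=t]) (auto simp: hB)
  moreover have "(\<Sum>i\<in>leaves_below A k. density_plan A B h i j)
      = leaf_cond_prob B j l * node_mass A B (density_plan A B h) k l"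
    if t: "t \<in> {1..num_stages A}" and "k \<in> stage A t" "l \<in> stage B t" "j \<in> leaves_below B l" for t k l j
  proof -
    have "(\<Sum>i\<in>leaves_below A k. density_plan B A (\<lambda>t x y. h t y x) j i)
      = leaf_cond_prob B j l * node_mass B A (density_plan B A (\<lambda>t x y. h t y x)) l k"
      using that stages
      by (intro density_plan_conditional[OF B A stages[symmetric] indepA, where t=t]) (auto simp: hA)
    moreover have "node_mass B A (density_plan B A (\<lambda>t x y. h t y x)) l k
        = node_mass A B (density_plan A B h) k l"
      unfolding node_mass_def density_plan_swap[OF stages] by (rule sum.swap)
    ultimately show ?thesis by (simp add: density_plan_swap[OF stages])
  qed
  ultimately show ?thesis unfolding nested_plans_def by blast
qed

text \<open>For a cost that depends on stage \<open>s\<close> only, the densities of the other stages integrate to one.\<close>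

lemma density_plan_stage_cost:
  fixes c :: "'x \<Rightarrow> 'x \<Rightarrow> real"
  assumes A: "probability_tree Xi A" and B: "probability_tree Xi B"
    and indepB: "stagewise_independent B"
    and hB: "\<And>s i. s \<in> {1..num_stages B} \<Longrightarrow> i \<in> leaves A \<Longrightarrow> stage_mean B s (h s (scenario A i s)) = 1"
    and s: "s \<in> {1..num_stages B}"
  shows "(\<Sum>i\<in>leaves A. \<Sum>j\<in>leaves B. c (scenario A i s) (scenario B j s) * density_plan A B h i j)
    = stage_mean A s (\<lambda>x. stage_mean B s (\<lambda>y. c x y * h s x y))"
proof -
  interpret A: probability_tree Xi A by fact
  interpret B: probability_tree Xi B by fact
  have "(\<Sum>j\<in>leaves B. c (scenario A i s) (scenario B j s) * density_plan A B h i j)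
      = leaf_prob A i * stage_mean B s (\<lambda>y. c (scenario A i s) y * h s (scenario A i s) y)"
    if i: "i \<in> leaves A" for i
  proof -
    \<comment> \<open>The cost is absorbed into the factor of stage \<open>s\<close>, so that the product rule applies.\<close>
    define f where "f = (\<lambda>t y. (if t = s then c (scenario A i s) y else 1) * h t (scenario A i t) y)"
    have "(\<Prod>t\<in>{1..num_stages B}. f t (scenario B j t)) = c (scenario A i s) (scenario B j s) *
        (\<Prod>t\<in>{1..num_stages B}. h t (scenario A i t) (scenario B j t))" for j
    proof -
      have "(\<Prod>t\<in>{1..num_stages B}. f t (scenario B j t))
        = (\<Prod>t\<in>{1..num_stages B}. if t = s then c (scenario A i s) (scenario B j t) else 1) *
          (\<Prod>t\<in>{1..num_stages B}. h t (scenario A i t) (scenario B j t))"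
        unfolding prod.distrib[symmetric] by (intro prod.cong) (auto simp: f_def)
      then show ?thesis using s by (simp add: prod.delta)
    qed
    then have "(\<Sum>j\<in>leaves B. c (scenario A i s) (scenario B j s) * density_plan A B h i j)
      = leaf_prob A i *
        (\<Sum>j\<in>leaves B. leaf_prob B j * (\<Prod>t\<in>{1..num_stages B}. f t (scenario B j t)))"
      by (simp add: density_plan_def sum_distrib_left mult_ac)
    also have "\<dots> = leaf_prob A i * (\<Prod>t\<in>{1..num_stages B}. stage_mean B t (f t))"
      by (simp only: B.mean_of_product[OF indepB])
    also have "(\<Prod>t\<in>{1..num_stages B}. stage_mean B t (f t))
        = (\<Prod>t\<in>{1..num_stages B}. if t = s then stage_mean B s (f s) else 1)"
    proof (intro prod.cong refl)
      fix t assume "t \<in> {1..num_stages B}"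
      then show "stage_mean B t (f t) = (if t = s then stage_mean B s (f s) else 1)"
        using hB[OF _ i, of t] by (auto simp: f_def)
    qed
    also have "\<dots> = stage_mean B s (f s)" using s by (simp add: prod.delta)
    finally show ?thesis by (simp add: f_def)
  qed
  then show ?thesis by (simp add: stage_mean_def[of A])
qed

text \<open>The gluing result: plans for the single stages combine to a nested plan whose cost is the sum of
  theirs.\<close>

lemma nested_plan_of_stage_plans:
  fixes \<tau> :: "nat \<Rightarrow> 'x \<Rightarrow> 'x \<Rightarrow> real"
  assumes A: "probability_tree Xi A" and B: "probability_tree Xi B"
    and stages: "num_stages A = num_stages B"
    and indepA: "stagewise_independent A" and indepB: "stagewise_independent B"
    and \<tau>: "\<And>t. t \<in> {1..num_stages B} \<Longrightarrow> \<tau> t \<in> transport_plans (marginal A t) (marginal B t)"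
  obtains \<pi> where "\<pi> \<in> nested_plans A B"
    and "\<And>s c. s \<in> {1..num_stages B} \<Longrightarrow>
      (\<Sum>i\<in>leaves A. \<Sum>j\<in>leaves B. c (scenario A i s) (scenario B j s) * \<pi> i j)
      = (\<Sum>x\<in>set_pmf (marginal A s). \<Sum>y\<in>set_pmf (marginal B s). c x y * \<tau> s x y)"
proof -
  interpret A: probability_tree Xi A by fact
  interpret B: probability_tree Xi B by fact
  define h where "h = (\<lambda>t x y. \<tau> t x y / (pmf (marginal A t) x * pmf (marginal B t) y))"
  have pos: "0 < pmf (marginal A t) x" if "x \<in> set_pmf (marginal A t)" for t x
    using that by (rule pmf_positive)
  have h1: "(\<Sum>y\<in>set_pmf (marginal B t). pmf (marginal B t) y * (c y * h t x y))
      = (\<Sum>y\<in>set_pmf (marginal B t). c y * \<tau> t x y) / pmf (marginal A t) x" for t x c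
    unfolding sum_divide_distrib h_def
    by (intro sum.cong refl) (simp add: set_pmf_iff)
  have hB: "stage_mean B t (h t (scenario A i t)) = 1"
    if "t \<in> {1..num_stages B}" "i \<in> leaves A" for t i
  proof -
    have x: "scenario A i t \<in> set_pmf (marginal A t)" using that(2) by (simp add: A.set_marginal)
    then show ?thesis
      using h1[of t "\<lambda>_. 1" "scenario A i t"] \<tau>[OF that(1)] pos[OF x]
      by (simp add: B.stage_mean_marginal transport_plans_def)
  qed
  have hA: "stage_mean A t (\<lambda>x. h t x (scenario B j t)) = 1"
    if "t \<in> {1..num_stages B}" "j \<in> leaves B" for t j
  proof -
    let ?y = "scenario B j t"
    have y: "?y \<in> set_pmf (marginal B t)" using that(2) by (simp add: B.set_marginal)
    have "stage_mean A t (\<lambda>x. h t x ?y) = (\<Sum>x\<in>set_pmf (marginal A t). \<tau> t x ?y) / pmf (marginal B t) ?y"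
      unfolding A.stage_mean_marginal sum_divide_distrib h_def
      by (intro sum.cong refl) (simp add: set_pmf_iff)
    then show ?thesis
      using \<tau>[OF that(1)] y pmf_positive[OF y] by (simp add: transport_plans_def)
  qed
  have "0 \<le> h t (scenario A i t) (scenario B j t)"
    if "t \<in> {1..num_stages B}" "i \<in> leaves A" "j \<in> leaves B" for t i j
    using \<tau>[OF that(1)] that(2,3)
    by (auto simp: h_def transport_plans_def A.set_marginal B.set_marginal)
  then have plan: "density_plan A B h \<in> nested_plans A B"
    using density_plan_nested[OF A B stages indepA indepB, of h] hA hB by blast
  have "(\<Sum>i\<in>leaves A. \<Sum>j\<in>leaves B. c (scenario A i s) (scenario B j s) * density_plan A B h i j)
      = (\<Sum>x\<in>set_pmf (marginal A s). \<Sum>y\<in>set_pmf (marginal B s). c x y * \<tau> s x y)"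
    if s: "s \<in> {1..num_stages B}" for s c
  proof -
    have "(\<Sum>i\<in>leaves A. \<Sum>j\<in>leaves B. c (scenario A i s) (scenario B j s) * density_plan A B h i j)
      = stage_mean A s (\<lambda>x. stage_mean B s (\<lambda>y. c x y * h s x y))"
      by (rule density_plan_stage_cost[OF A B indepB _ s]) (rule hB)
    also have "\<dots> = (\<Sum>x\<in>set_pmf (marginal A s). \<Sum>y\<in>set_pmf (marginal B s). c x y * \<tau> s x y)"
      unfolding A.stage_mean_marginal B.stage_mean_marginal h1
      by (intro sum.cong refl) (simp add: set_pmf_iff)
    finally show ?thesis .
  qed
  with plan show ?thesis by (rule that)
qed

section \<open>The nested distance of stagewise independent trees\<close>

lemma product_plan_transport:
  assumes "finite (set_pmf P)" "finite (set_pmf Q)"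
  shows "(\<lambda>x y. pmf P x * pmf Q y) \<in> transport_plans P Q"
  using assms by (simp add: transport_plans_def sum_pmf_eq_1 flip: sum_distrib_left sum_distrib_right)

lemma wasserstein_pow_le:
  assumes "\<pi> \<in> transport_plans P Q"
  shows "wasserstein_pow p d P Q \<le> (\<Sum>x\<in>set_pmf P. \<Sum>y\<in>set_pmf Q. d x y powr p * \<pi> x y)"
  unfolding wasserstein_pow_def
  by (rule cINF_lower[OF _ assms], rule bdd_belowI[of _ 0])
    (auto simp: transport_plans_def intro!: sum_nonneg)

lemma wasserstein_pow_approx:
  assumes "finite (set_pmf P)" "finite (set_pmf Q)" "0 < e"
  shows "\<exists>\<pi>\<in>transport_plans P Q.
    (\<Sum>x\<in>set_pmf P. \<Sum>y\<in>set_pmf Q. d x y powr p * \<pi> x y) < wasserstein_pow p d P Q + e"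
proof -
  let ?f = "\<lambda>\<pi>. \<Sum>x\<in>set_pmf P. \<Sum>y\<in>set_pmf Q. d x y powr p * \<pi> x y"
  have "?f ` transport_plans P Q \<noteq> {}" using product_plan_transport[OF assms(1,2)] by blast
  moreover have "Inf (?f ` transport_plans P Q) < wasserstein_pow p d P Q + e"
    using assms(3) by (simp add: wasserstein_pow_def)
  ultimately have "\<exists>v\<in>?f ` transport_plans P Q. v < wasserstein_pow p d P Q + e"
    by (rule cInf_lessD)
  then show ?thesis by (simp only: bex_simps)
qed

lemma nested_pow_le:
  assumes "\<pi> \<in> nested_plans A B"
  shows "nested_pow p d A B \<le>
    (\<Sum>i\<in>leaves A. \<Sum>j\<in>leaves B. d (scenario A i) (scenario B j) powr p * \<pi> i j)"
  unfolding nested_pow_def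
  by (rule cINF_lower[OF _ assms], rule bdd_belowI[of _ 0])
    (auto simp: nested_plans_def intro!: sum_nonneg)

theorem theorem1:
  fixes p :: real and T :: nat
    and Xi :: "nat \<Rightarrow> 'x set"
    and A :: "('a, 'x) ptree" and B :: "('b, 'x) ptree"
    and dt :: "nat \<Rightarrow> 'x \<Rightarrow> 'x \<Rightarrow> real"
    and d :: "(nat \<Rightarrow> 'x) \<Rightarrow> (nat \<Rightarrow> 'x) \<Rightarrow> real"
    and w :: "nat \<Rightarrow> real"
  assumes "1 \<le> p" and "1 \<le> T"
    and "probability_tree Xi A" and "num_stages A = T" and "stagewise_independent A"
    and "probability_tree Xi B" and "num_stages B = T" and "stagewise_independent B"
    and "\<And>t. t \<in> {1..T} \<Longrightarrow> distance_on (Xi t) (dt t)"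
    and "\<And>t. t \<in> {1..T} \<Longrightarrow> 0 \<le> w t"
    and "distance_on (\<Pi>\<^sub>E t\<in>{1..T}. Xi t) d"
    and "\<And>\<xi> \<zeta>. \<lbrakk>\<xi> \<in> (\<Pi>\<^sub>E t\<in>{1..T}. Xi t); \<zeta> \<in> (\<Pi>\<^sub>E t\<in>{1..T}. Xi t)\<rbrakk> \<Longrightarrow>
           d \<xi> \<zeta> powr p = (\<Sum>t=1..T. w t * dt t (\<xi> t) (\<zeta> t) powr p)"
  shows "nested_pow p d A B =
    (\<Sum>t=1..T. w t * wasserstein_pow p (dt t) (marginal A t) (marginal B t))"
proof -
  note A = assms(3) and B = assms(6)
  note stagesA = assms(4) and stagesB = assms(7)
  note indepA = assms(5) and indepB = assms(8)
  interpret A: probability_tree Xi A by fact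
  interpret B: probability_tree Xi B by fact
  let ?W = "\<lambda>t. wasserstein_pow p (dt t) (marginal A t) (marginal B t)"
  let ?cost = "\<lambda>\<pi>. \<Sum>i\<in>leaves A. \<Sum>j\<in>leaves B. d (scenario A i) (scenario B j) powr p * \<pi> i j"
  let ?stage_cost = "\<lambda>t \<pi>. \<Sum>i\<in>leaves A. \<Sum>j\<in>leaves B.
    dt t (scenario A i t) (scenario B j t) powr p * \<pi> i j"
  have stages: "num_stages A = num_stages B" using stagesA stagesB by simp
  have cost: "?cost \<pi> = (\<Sum>t=1..T. w t * ?stage_cost t \<pi>)" for \<pi>
  proof -
    have "?cost \<pi> = (\<Sum>i\<in>leaves A. \<Sum>j\<in>leaves B. \<Sum>t=1..T.
        w t * (dt t (scenario A i t) (scenario B j t) powr p * \<pi> i j))"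
      using A.scenario_in B.scenario_in stagesA stagesB
      by (intro sum.cong refl) (simp add: assms(12) sum_distrib_right mult.assoc)
    also have "\<dots> = (\<Sum>i\<in>leaves A. \<Sum>t=1..T. \<Sum>j\<in>leaves B.
        w t * (dt t (scenario A i t) (scenario B j t) powr p * \<pi> i j))"
      by (intro sum.cong refl sum.swap)
    also have "\<dots> = (\<Sum>t=1..T. \<Sum>i\<in>leaves A. \<Sum>j\<in>leaves B.
        w t * (dt t (scenario A i t) (scenario B j t) powr p * \<pi> i j))"
      by (rule sum.swap)
    finally show ?thesis by (simp add: sum_distrib_left)
  qed
  have plan_below: "\<exists>\<pi>\<in>nested_plans A B. ?cost \<pi> \<le> (\<Sum>t=1..T. w t * ?W t) + e * (\<Sum>t=1..T. w t)"
    if "0 < e" for e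
  proof -
    have "\<forall>t. \<exists>\<tau>\<in>transport_plans (marginal A t) (marginal B t).
      (\<Sum>x\<in>set_pmf (marginal A t). \<Sum>y\<in>set_pmf (marginal B t). dt t x y powr p * \<tau> x y) < ?W t + e"
      using wasserstein_pow_approx[OF A.finite_set_marginal B.finite_set_marginal \<open>0 < e\<close>] by blast
    then obtain \<tau> where \<tau>: "\<And>t. \<tau> t \<in> transport_plans (marginal A t) (marginal B t)"
      "\<And>t. (\<Sum>x\<in>set_pmf (marginal A t). \<Sum>y\<in>set_pmf (marginal B t). dt t x y powr p * \<tau> t x y) < ?W t + e"
      unfolding Bex_def by (auto dest!: choice)
    obtain \<pi> where \<pi>: "\<pi> \<in> nested_plans A B"
      "\<And>s c. s \<in> {1..num_stages B} \<Longrightarrow>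
        (\<Sum>i\<in>leaves A. \<Sum>j\<in>leaves B. c (scenario A i s) (scenario B j s) * \<pi> i j)
        = (\<Sum>x\<in>set_pmf (marginal A s). \<Sum>y\<in>set_pmf (marginal B s). c x y * \<tau> s x y)"
      by (rule nested_plan_of_stage_plans[OF A B stages indepA indepB \<tau>(1)]) (rule that)
    have "?stage_cost t \<pi> \<le> ?W t + e" if "t \<in> {1..T}" for t
      using \<pi>(2)[of t "\<lambda>x y. dt t x y powr p"] \<tau>(2)[of t] that stagesB by simp
    then have "?cost \<pi> \<le> (\<Sum>t=1..T. w t * (?W t + e))"
      unfolding cost using assms(10) by (intro sum_mono mult_left_mono) auto
    also have "\<dots> = (\<Sum>t=1..T. w t * ?W t) + e * (\<Sum>t=1..T. w t)"
      by (simp add: algebra_simps sum.distrib sum_distrib_left)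
    finally show ?thesis using \<pi>(1) by blast
  qed
  show ?thesis
  proof (rule antisym)
    show "nested_pow p d A B \<le> (\<Sum>t=1..T. w t * ?W t)"
    proof (rule field_le_epsilon)
      fix e :: real assume "0 < e"
      \<comment> \<open>The summand 1 keeps the divisor positive when all weights vanish.\<close>
      define e' where "e' = e / ((\<Sum>t=1..T. w t) + 1)"
      have w: "0 \<le> (\<Sum>t=1..T. w t)" using assms(10) by (intro sum_nonneg) auto
      then have "0 < e'" "e' * (\<Sum>t=1..T. w t) \<le> e"
        using \<open>0 < e\<close> by (auto simp: e'_def field_simps)
      then obtain \<pi> where \<pi>: "\<pi> \<in> nested_plans A B"
        and "?cost \<pi> \<le> (\<Sum>t=1..T. w t * ?W t) + e' * (\<Sum>t=1..T. w t)"
        using plan_below[of e'] by blast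
      with nested_pow_le[OF \<pi>, of p d] \<open>e' * (\<Sum>t=1..T. w t) \<le> e\<close>
      show "nested_pow p d A B \<le> (\<Sum>t=1..T. w t * ?W t) + e" by linarith
    qed
    show "(\<Sum>t=1..T. w t * ?W t) \<le> nested_pow p d A B"
      unfolding nested_pow_def
    proof (rule cINF_greatest)
      show "nested_plans A B \<noteq> {}" using plan_below[of 1] by auto
      fix \<pi> assume \<pi>: "\<pi> \<in> nested_plans A B"
      have "?W t \<le> ?stage_cost t \<pi>" for t
        using wasserstein_pow_le[OF stage_plan_transport[OF A B \<pi>, of t], of p "dt t"]
          stage_plan_cost[OF A B, where c="\<lambda>x y. dt t x y powr p" and t=t and \<pi>=\<pi>] by simp
      then show "(\<Sum>t=1..T. w t * ?W t) \<le> ?cost \<pi>"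
        unfolding cost using assms(10) by (intro sum_mono mult_left_mono) auto
    qed
  qed
qed

end
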